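(* Let $q = p^n > 2$, where $p$ is a prime and $n \geq 1$ is an integer. Then the Laplacian spectrum of the non-commuting graph $\mathcal{A}_{GL(2,q)}$ of the general linear group $GL(2,q)$ (over the field with $q$ elements) is $$\{0, (q^4-q^3-2q^2+q+1)^{\frac{q^4-2q^3+q}{2}}, (q^4-q^3-2q^2+2q)^{q^3-q^2-2q}, (q^4-q^3-2q^2+3q-1)^{\frac{q^4-2q^3-2q^2+q}{2}}, (q^4-q^3-q^2+1)^{q^2+q}\}.$$
   Context: For a finite non-abelian group $G$ with centre $Z(G)$, the non-commuting graph $\mathcal{A}_G$ is the simple undirected graph with vertex set $G \setminus Z(G)$ in which two vertices $x,y$ are adjacent if and only if $xy \neq yx$. The Laplacian matrix of a finite graph is $D - A$, with $D$ the degree matrix and $A$ the adjacency matrix. The Laplacian spectrum is the multiset of eigenvalues of the Laplacian matrix; $\{\dots,\alpha^{a},\dots\}$ means the eigenvalue $\alpha$ is listed with multiplicity $a$ (not a power; no exponent means once, exponent $0$ means the entry is absent, and if listed values coincide their multiplicities add). *)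

theory Defs
  imports
    "HOL-Algebra.Group"
    "HOL-Computational_Algebra.Computational_Algebra"
    "HOL-Library.Cardinality"
    "Graph_Theory.Pair_Digraph"
    "Jordan_Normal_Form.Char_Poly"
begin

definition group_centre :: "('a, 'b) monoid_scheme \<Rightarrow> 'a set" where
  "group_centre G =
     {z \<in> carrier G. \<forall>x \<in> carrier G. z \<otimes>\<^bsub>G\<^esub> x = x \<otimes>\<^bsub>G\<^esub> z}"

text \<open>Simple undirected graphs are represented, as in the locale \<^locale>\<open>pair_graph\<close>, by
  symmetric loop-free arc relations.\<close>

definition noncommuting_graph :: "('a, 'b) monoid_scheme \<Rightarrow> 'a pair_pre_digraph" where
  "noncommuting_graph G =
     \<lparr>pverts = carrier G - group_centre G,
      parcs = {(x, y). x \<in> carrier G - group_centre G \<and> y \<in> carrier G - group_centre G \<and>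
                       x \<otimes>\<^bsub>G\<^esub> y \<noteq> y \<otimes>\<^bsub>G\<^esub> x}\<rparr>"

lemma pair_graph_noncommuting_graph:
  assumes "finite (carrier G)"
  shows "pair_graph (noncommuting_graph G)"
proof -
  have "finite (parcs (noncommuting_graph G))"
    by (rule finite_subset[of _ "carrier G \<times> carrier G"])
       (use assms in \<open>auto simp: noncommuting_graph_def\<close>)
  moreover have "sym (parcs (noncommuting_graph G))"
    by (auto simp: noncommuting_graph_def sym_def)
  ultimately show ?thesis
    using assms by unfold_locales (auto simp: noncommuting_graph_def symmetric_def)
qed

text \<open>The rows and columns of a matrix are numbered, so the following matrices depend on an
  enumeration \<open>vs\<close> (a distinct list) of the vertex set. For a symmetric arc relation the out-degree
  is the usual degree.\<close>

definition adjacency_mat :: "'a pair_pre_digraph \<Rightarrow> 'a list \<Rightarrow> real mat" where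
  "adjacency_mat G vs =
     mat (length vs) (length vs) (\<lambda>(i, j). if (vs ! i, vs ! j) \<in> parcs G then 1 else 0)"

definition degree_mat :: "'a pair_pre_digraph \<Rightarrow> 'a list \<Rightarrow> real mat" where
  "degree_mat G vs =
     mat (length vs) (length vs)
       (\<lambda>(i, j). if i = j then real (out_degree (with_proj G) (vs ! i)) else 0)"

definition laplacian_mat :: "'a pair_pre_digraph \<Rightarrow> 'a list \<Rightarrow> real mat" where
  "laplacian_mat G vs = degree_mat G vs - adjacency_mat G vs"

text \<open>Eigenvalues with multiplicity. The Laplacian matrix is real symmetric, so all the complex
  roots of its characteristic polynomial are real and counted here, and algebraic and geometric
  multiplicities agree.\<close>

definition laplacian_spectrum :: "'a pair_pre_digraph \<Rightarrow> 'a list \<Rightarrow> real multiset" where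
  "laplacian_spectrum G vs = proots (char_poly (laplacian_mat G vs))"

definition general_linear_group :: "'a :: field itself \<Rightarrow> nat \<Rightarrow> 'a mat monoid" where
  "general_linear_group ty m = units_of (ring_mat ty m ())"

lemma group_general_linear_group: "group (general_linear_group TYPE('a :: field) m)"
proof -
  interpret ring "ring_mat TYPE('a) m ()" by (rule ring_mat)
  show ?thesis unfolding general_linear_group_def by (rule units_group)
qed

end

(*
Commuting is an equivalence relation on the noncentral elements of GL(2,q), so the graph is complete
multipartite. Its parts are the sets of noncentral elements of the centralizers
{xI + yA | det (xI + yA) /= 0} of nonscalar matrices A. Taking y /= 0 gives a part of size (q-1)(q-r),
where r = 0, 1, 2 is the number of eigenvalues of A in the field. Counting the matrices with given
eigenvalues and dividing by the part sizes yields the number of parts of each size.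

The characteristic polynomial of a complete multipartite graph follows from the matrix determinant
lemma: off finitely many points, xI - L arises from an invertible diagonal matrix by subtracting an
all-one block for every part and then adding the all-one matrix, each a rank-one update.
*)
theory Submission
  imports Defs
begin

section \<open>Determinants under rank-one updates\<close>

text \<open>Matrix determinant lemma with a solution \<open>y\<close> of A y = u in place of the
  inverse of A. The bordered matrix \<open>M\<close> with blocks A, -u, z, 1 is multiplied on the
  right by two unitriangular matrices: \<open>L\<close> clears -u and leaves 1 + z y in the corner,
  \<open>R\<close> clears z and leaves A + u z. Comparing the two values of \<open>det M\<close>
  gives the formula.\<close>

lemma det_rank_one_update:
  fixes f :: "nat \<Rightarrow> nat \<Rightarrow> 'a :: idom"
  assumes y: "\<And>i. i < n \<Longrightarrow> (\<Sum>j<n. f i j * y j) = u i"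
  shows "det (mat n n (\<lambda>(i, j). f i j + u i * z j)) =
         det (mat n n (\<lambda>(i, j). f i j)) * (1 + (\<Sum>j<n. z j * y j))"
proof -
  define A where "A = mat n n (\<lambda>(i, j). f i j)"
  define U where "U = mat n 1 (\<lambda>(i, j). u i)"
  define Y where "Y = mat n 1 (\<lambda>(i, j). y i)"
  define Z where "Z = mat 1 n (\<lambda>(i, j). z j)"
  define M where "M = four_block_mat A (- U) Z (1\<^sub>m 1)"
  have c: "A \<in> carrier_mat n n" "U \<in> carrier_mat n 1" "Y \<in> carrier_mat n 1" "Z \<in> carrier_mat 1 n"
    by (auto simp: A_def U_def Y_def Z_def)
  have cM: "M \<in> carrier_mat (n + 1) (n + 1)"
    unfolding M_def using c by (intro four_block_carrier_mat) auto
  define L where "L = four_block_mat (1\<^sub>m n) Y (0\<^sub>m 1 n) (1\<^sub>m 1)"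
  define R where "R = four_block_mat (1\<^sub>m n) (0\<^sub>m n 1) (- Z) (1\<^sub>m 1)"
  have cL: "L \<in> carrier_mat (n + 1) (n + 1)" and cR: "R \<in> carrier_mat (n + 1) (n + 1)"
    unfolding L_def R_def using c by (auto intro!: four_block_carrier_mat)
  have AY: "A * Y = U"
    by (rule eq_matI)
       (auto simp: A_def U_def Y_def scalar_prod_def y[symmetric] atLeast0LessThan)
  have UZ: "A + U * Z = mat n n (\<lambda>(i, j). f i j + u i * z j)"
    by (rule eq_matI) (auto simp: A_def U_def Z_def scalar_prod_def)
  have MtL: "M * L = four_block_mat A (0\<^sub>m n 1) Z (Z * Y + 1\<^sub>m 1)"
    unfolding M_def L_def
    by (subst mult_four_block_mat[of _ n n _ 1 _ 1])
       (use c in \<open>auto intro!: cong_four_block_mat simp: AY uminus_l_inv_mat add_uminus_minus_mat[symmetric]\<close>)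
  have MtR: "M * R = four_block_mat (A + U * Z) (- U) (0\<^sub>m 1 n) (1\<^sub>m 1)"
    unfolding M_def R_def
    by (subst mult_four_block_mat[of _ n n _ 1 _ 1])
       (use c in \<open>auto intro!: cong_four_block_mat\<close>)
  have "det M * det L = det (M * L)" using cM cL by (simp add: det_mult)
  also have "\<dots> = det A * det (Z * Y + 1\<^sub>m 1)"
    unfolding MtL by (rule det_four_block_mat_upper_right_zero) (use c in auto)
  also have "det (Z * Y + 1\<^sub>m 1) = 1 + (\<Sum>j<n. z j * y j)"
    by (subst det_single)
       (auto simp: Z_def Y_def scalar_prod_def atLeast0LessThan add.commute)
  also have "det L = 1"
    unfolding L_def by (subst det_four_block_mat_lower_left_zero) (use c in auto)
  finally have 1: "det M = det A * (1 + (\<Sum>j<n. z j * y j))" by simp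
  have "det M * det R = det (M * R)" using cM cR by (simp add: det_mult)
  also have "\<dots> = det (A + U * Z) * det (1\<^sub>m 1)"
    unfolding MtR by (rule det_four_block_mat_lower_left_zero) (use c in auto)
  also have "det R = 1"
    unfolding R_def by (subst det_four_block_mat_upper_right_zero) (use c in auto)
  finally have 2: "det M = det (A + U * Z)" by simp
  show ?thesis using 1 unfolding 2 UZ unfolding A_def .
qed

text \<open>Induction on the set of subtracted blocks: each new block is the outer square of the
  indicator vector of its class, so subtracting it is a rank-one update. It contributes the factor 1
  - s / d, with s the class size.\<close>

lemma det_diag_minus_blocks:
  fixes d :: "'b \<Rightarrow> 'a :: field" and c :: "nat \<Rightarrow> 'b"
  assumes "finite S" and d: "\<And>b. b \<in> S \<Longrightarrow> d b \<noteq> 0"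
  shows "det (mat n n (\<lambda>(i, j). (if i = j then d (c i) else 0)
                                - (if c i = c j \<and> c i \<in> S then 1 else 0))) =
         (\<Prod>i<n. d (c i)) * (\<Prod>b\<in>S. 1 - of_nat (card {i. i < n \<and> c i = b}) / d b)"
  using assms
proof (induction S)
  case empty
  have "det (mat n n (\<lambda>(i, j). if i = j then d (c i) else 0)) =
        prod_list (diag_mat (mat n n (\<lambda>(i, j). if i = j then d (c i) else 0)))"
    by (rule det_upper_triangular[of _ n]) auto
  also have "\<dots> = (\<Prod>i<n. d (c i))"
    by (auto simp: diag_mat_def prod.list_conv_set_nth atLeast0LessThan intro!: prod.cong)
  finally show ?case by simp
next
  case (insert b S)
  define f where "f i j = (if i = j then d (c i) else 0)
      - (if c i = c j \<and> c i \<in> S then 1 else 0)" for i j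
  define u :: "nat \<Rightarrow> 'a" where "u i = (if c i = b then -1 else 0)" for i
  define z :: "nat \<Rightarrow> 'a" where "z i = (if c i = b then 1 else 0)" for i
  \<comment> \<open>On the columns of class \<open>b\<close>, \<open>f\<close> is still diagonal
    with entry \<open>d b\<close>, so the solution is \<open>u\<close> divided by
    \<open>d b\<close>.\<close>
  define y :: "nat \<Rightarrow> 'a" where "y i = (if c i = b then - 1 / d b else 0)" for i
  have y: "(\<Sum>j<n. f i j * y j) = u i" if "i < n" for i
  proof -
    have "(\<Sum>j<n. f i j * y j) = (\<Sum>j<n. if j = i then d (c i) * y i else 0)"
      using insert.hyps by (intro sum.cong) (auto simp: f_def y_def)
    also have "\<dots> = u i" using that insert.prems by (simp add: y_def u_def)
    finally show ?thesis .
  qed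
  have zy: "(\<Sum>j<n. z j * y j) = - (of_nat (card {i. i < n \<and> c i = b}) / d b)"
  proof -
    have "(\<Sum>j<n. z j * y j) = (\<Sum>j\<in>{i. i < n \<and> c i = b}. - 1 / d b)"
      by (intro sum.mono_neutral_cong_right) (auto simp: z_def y_def)
    thus ?thesis by simp
  qed
  have "det (mat n n (\<lambda>(i, j). (if i = j then d (c i) else 0)
                                - (if c i = c j \<and> c i \<in> insert b S then 1 else 0)))
        = det (mat n n (\<lambda>(i, j). f i j + u i * z j))"
    using insert.hyps by (intro arg_cong[of _ _ det] eq_matI) (auto simp: f_def u_def z_def)
  also have "\<dots> = det (mat n n (\<lambda>(i, j). f i j)) * (1 + (\<Sum>j<n. z j * y j))"
    by (rule det_rank_one_update[OF y])
  also have "det (mat n n (\<lambda>(i, j). f i j)) =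
      (\<Prod>i<n. d (c i)) * (\<Prod>b\<in>S. 1 - of_nat (card {i. i < n \<and> c i = b}) / d b)"
    unfolding f_def by (rule insert.IH) (use insert.prems in auto)
  finally show ?case unfolding zy using insert.hyps by (simp add: algebra_simps)
qed

text \<open>The matrix is a diagonal one minus the all-one block of every class plus the all-one
  matrix, and the last summand is one more rank-one update.\<close>

lemma det_multipartite:
  fixes c :: "nat \<Rightarrow> 'b" and t :: real and n :: nat
  assumes t: "t > 0"
  defines "S \<equiv> c ` {..<n}"
  defines "s \<equiv> (\<lambda>b. card {i. i < n \<and> c i = b})"
  shows "det (mat n n (\<lambda>(i, j). (if i = j then t + s (c i) else 0)
                                + (if c i = c j then 0 else 1))) =
         (\<Prod>b\<in>S. (t + s b) ^ (s b - 1) * t) * (1 + n / t)"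
proof -
  define d where "d b = t + s b" for b
  have d: "d b \<noteq> 0" for b using t by (simp add: d_def add_pos_nonneg less_imp_neq[symmetric])
  define f where "f i j = (if i = j then d (c i) else 0)
      - (if c i = c j \<and> c i \<in> S then 1 else 0)" for i j
  \<comment> \<open>In row i the diagonal contributes t + s, and 1 is subtracted at each of the s
    indices of the class of i. Every row therefore sums to \<open>t\<close>, and the constant vector
    1 / t is the required solution.\<close>
  have y: "(\<Sum>j<n. f i j * (1 / t)) = 1" if "i < n" for i
  proof -
    have "(\<Sum>j<n. f i j) = (\<Sum>j<n. if i = j then d (c i) else 0)
        - (\<Sum>j<n. if c i = c j \<and> c i \<in> S then 1 else 0)"
      by (simp add: f_def sum_subtractf)
    also have "(\<Sum>j<n. if c i = c j \<and> c i \<in> S then 1 else (0::real)) =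
        (\<Sum>j\<in>{j. j < n \<and> c j = c i}. 1)"
      using that by (intro sum.mono_neutral_cong_right) (auto simp: S_def)
    finally have "(\<Sum>j<n. f i j) = t" using that by (simp add: d_def s_def)
    thus ?thesis using t by (simp add: sum_divide_distrib[symmetric])
  qed
  have "det (mat n n (\<lambda>(i, j). (if i = j then t + s (c i) else 0) + (if c i = c j then 0 else 1)))
      = det (mat n n (\<lambda>(i, j). f i j + 1 * 1))"
    by (intro arg_cong[of _ _ det] eq_matI) (auto simp: f_def d_def S_def)
  also have "\<dots> = det (mat n n (\<lambda>(i, j). f i j)) * (1 + (\<Sum>j<n. 1 * (1 / t)))"
    by (rule det_rank_one_update[OF y])
  also have "det (mat n n (\<lambda>(i, j). f i j)) =
      (\<Prod>i<n. d (c i)) * (\<Prod>b\<in>S. 1 - of_nat (card {i. i < n \<and> c i = b}) / d b)"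
    unfolding f_def by (rule det_diag_minus_blocks) (auto simp: S_def d)
  also have "(\<Prod>i<n. d (c i)) = (\<Prod>b\<in>S. d b ^ s b)"
  proof -
    have "(\<Prod>i<n. d (c i)) = (\<Prod>b\<in>S. \<Prod>i\<in>{i. i < n \<and> c i = b}. d (c i))"
      unfolding S_def by (subst prod.image_gen[of _ _ c]) auto
    thus ?thesis by (simp add: s_def)
  qed
  also have "(\<Prod>b\<in>S. d b ^ s b) * (\<Prod>b\<in>S. 1 - of_nat (card {i. i < n \<and> c i = b}) / d b)
     = (\<Prod>b\<in>S. (t + s b) ^ (s b - 1) * t)"
    unfolding prod.distrib[symmetric]
  proof (rule prod.cong)
    fix b assume "b \<in> S"
    \<comment> \<open>The class of \<open>b\<close> is nonempty, so the exponent
      \<open>s b - 1\<close> is not truncated; 1 - s / d = t / d then trades one factor d for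
      t.\<close>
    hence "s b \<noteq> 0" by (auto simp: S_def s_def card_eq_0_iff)
    then obtain m where m: "s b = Suc m" by (cases "s b") auto
    have "1 - s b / d b = t / d b" using d[of b] by (simp add: d_def field_simps)
    hence "d b ^ s b * (1 - s b / d b) = (t + s b) ^ (s b - 1) * t"
      using d[of b] by (simp add: m, simp add: d_def m)
    thus "d b ^ s b * (1 - card {i. i < n \<and> c i = b} / d b) = (t + s b) ^ (s b - 1) * t"
      by (simp add: s_def)
  qed simp
  finally show ?thesis by simp
qed

section \<open>The Laplacian spectrum of complete multipartite graphs\<close>

text \<open>Here \<open>c\<close> labels the parts, and a vertex in a part of size s has degree N -
  s. For x > N the matrix x I - L has the shape of \<open>det_multipartite\<close> with t = x - N.
  Agreement at infinitely many points then identifies the characteristic polynomial with the product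
  \<open>P\<close>, whose roots can be read off.\<close>

lemma laplacian_spectrum_complete_multipartite:
  fixes c :: "'a \<Rightarrow> 'b"
  assumes vs: "distinct vs" "set vs = pverts G"
    and arcs: "parcs G = {(x, y). x \<in> pverts G \<and> y \<in> pverts G \<and> c x \<noteq> c y}"
    and ne: "pverts G \<noteq> {}"
  defines "s \<equiv> (\<lambda>b. card {x \<in> pverts G. c x = b})"
  defines "N \<equiv> card (pverts G)"
  shows "laplacian_spectrum G vs = {#0#} + replicate_mset (card (c ` pverts G) - 1) (real N) +
           (\<Sum>b\<in>c ` pverts G. replicate_mset (s b - 1) (real N - real (s b)))"
proof -
  define V where "V = pverts G"
  define n where "n = length vs"
  define S where "S = c ` V"
  have V: "finite V" "set vs = V" using vs by (auto simp: V_def simp flip: vs(2))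
  have nN: "n = N" using vs by (metis N_def n_def distinct_card)
  have n0: "n > 0" using nN ne V by (simp add: N_def card_gt_0_iff V_def)
  have inj: "inj_on ((!) vs) {..<n}" using vs by (simp add: inj_on_nth n_def)
  have img: "(!) vs ` {..<n} = V" using V by (auto simp: n_def in_set_conv_nth image_iff)
  have mem: "vs ! i \<in> V" if "i < n" for i using that V by (auto simp: n_def)
  have s: "card {i. i < n \<and> c (vs ! i) = b} = s b" for b
  proof -
    have "{x \<in> V. c x = b} = (!) vs ` {i. i < n \<and> c (vs ! i) = b}"
      using img by auto
    moreover have "inj_on ((!) vs) {i. i < n \<and> c (vs ! i) = b}"
      using inj by (rule inj_on_subset) auto
    ultimately show ?thesis by (simp add: s_def V_def card_image)
  qed
  have deg: "real (out_degree (with_proj G) x) = real N - s (c x)" if "x \<in> V" for x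
  proof -
    have "out_arcs (with_proj G) x = Pair x ` (V - {y \<in> V. c y = c x})"
      using that by (auto simp: out_arcs_def arcs V_def)
    hence "out_degree (with_proj G) x = card (V - {y \<in> V. c y = c x})"
      by (simp add: out_degree_def card_image inj_on_def)
    also have "\<dots> = N - s (c x)"
      using V by (subst card_Diff_subset) (auto simp: N_def s_def V_def)
    finally show ?thesis
      using V by (simp add: of_nat_diff s_def N_def V_def card_mono)
  qed
  define L where "L = laplacian_mat G vs"
  have L: "L \<in> carrier_mat n n"
    by (auto simp: L_def laplacian_mat_def degree_mat_def adjacency_mat_def n_def)
  have SS: "S = (\<lambda>i. c (vs ! i)) ` {..<n}"
    unfolding S_def img[symmetric] by (simp add: image_image)
  have finS: "finite S" using V by (simp add: S_def)
  have S0: "card S > 0" using finS ne by (auto simp: S_def V_def card_gt_0_iff)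
  define P where "P = [:0, 1:] * [:- real N, 1:] ^ (card S - 1) *
      (\<Prod>b\<in>S. [:- (real N - real (s b)), 1:] ^ (s b - 1))"
  have ev: "poly (char_poly L) x = poly P x" if x: "x > real N" for x
  proof -
    define t where "t = x - N"
    have t: "t > 0" using x by (simp add: t_def)
    have "poly (char_poly L) x = det (- char_matrix L x)"
      by (rule char_poly_matrix[OF L])
    also have "- char_matrix L x = mat n n (\<lambda>(i, j).
        (if i = j then t + card {k. k < n \<and> c (vs ! k) = c (vs ! i)} else 0) +
        (if c (vs ! i) = c (vs ! j) then 0 else 1))"
      using mem deg
      by (intro eq_matI)
         (auto simp: char_matrix_def L_def laplacian_mat_def degree_mat_def adjacency_mat_def
            n_def[symmetric] s arcs t_def V_def)
    also have "det \<dots> = (\<Prod>b\<in>S. (t + s b) ^ (s b - 1) * t) * (1 + n / t)"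
      by (subst det_multipartite[OF t]) (auto simp: s SS)
    \<comment> \<open>One of the \<open>card S\<close> factors t is spent on clearing 1 + n / t. The
      resulting factor t + n equals x and yields the eigenvalue 0.\<close>
    also have "\<dots> = (\<Prod>b\<in>S. (t + s b) ^ (s b - 1)) * t ^ (card S - 1) * (t + n)"
      using t S0 by (cases "card S") (auto simp: prod.distrib field_simps)
    also have "\<dots> = poly P x"
      by (simp add: P_def poly_prod t_def nN algebra_simps)
    finally show ?thesis .
  qed
  have "char_poly L = P"
  proof (rule ccontr)
    assume "char_poly L \<noteq> P"
    hence "finite {x. poly (char_poly L - P) x = 0}" by (intro poly_roots_finite) auto
    moreover have "{real N<..} \<subseteq> {x. poly (char_poly L - P) x = 0}" using ev by auto
    ultimately show False using infinite_Ioi finite_subset by blast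
  qed
  hence "laplacian_spectrum G vs = proots P"
    by (simp add: laplacian_spectrum_def L_def)
  also have "\<dots> = {#0#} + replicate_mset (card S - 1) (real N) +
           (\<Sum>b\<in>S. replicate_mset (s b - 1) (real N - real (s b)))"
  proof -
    have nz: "[:- a, 1:] ^ k \<noteq> (0 :: real poly)" for a k by simp
    have "proots [:0, 1 :: real:] = {#0#}" using proots_linear_factor[of "0::real"] by simp
    thus ?thesis unfolding P_def
      by (subst proots_mult, simp add: finS, simp add: finS, subst proots_mult, simp, simp,
          subst proots_prod)
         (auto simp: proots_power finS)
  qed
  finally show ?thesis by (simp add: S_def V_def)
qed

section \<open>Commutation of 2 x 2 matrices\<close>

text \<open>Grouping the entries as diagonal and off-diagonal pairs turns sets cut out by conditions such
  as \<open>b * c = a * d\<close> into dependent products over the diagonal, which is how they are counted.\<close>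

definition mat2 :: "('a \<times> 'a) \<times> ('a \<times> 'a) \<Rightarrow> 'a :: field mat" where
  "mat2 = (\<lambda>((a, d), (b, c)). mat 2 2 (\<lambda>(i, j).
     if i = 0 then (if j = 0 then a else b) else (if j = 0 then c else d)))"

lemma mat2_carrier: "mat2 v \<in> carrier_mat 2 2"
  by (cases v) (auto simp: mat2_def)

lemma inj_mat2: "inj mat2"
proof (rule injI)
  fix v w :: "('a \<times> 'a) \<times> ('a \<times> 'a)"
  assume eq: "mat2 v = mat2 w"
  have "mat2 v $$ (i, j) = mat2 w $$ (i, j)" for i j by (simp add: eq)
  from this[of 0 0] this[of 0 1] this[of 1 0] this[of 1 1] show "v = w"
    by (cases v; cases w) (auto simp: mat2_def)
qed

lemma carrier_mat_2_2: "carrier_mat 2 2 = range mat2"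
proof (intro equalityI subsetI)
  fix A :: "'a mat" assume A: "A \<in> carrier_mat 2 2"
  have "A = mat2 ((A $$ (0, 0), A $$ (1, 1)), (A $$ (0, 1), A $$ (1, 0)))"
    by (rule eq_matI) (use A in \<open>auto simp: mat2_def less_2_cases_iff\<close>)
  thus "A \<in> range mat2" by blast
qed (auto simp: mat2_carrier)

lemma det_mat2: "det (mat2 ((a, d), (b, c))) = a * d - b * c"
  by (subst laplace_expansion_column[OF mat2_carrier, of 0])
     (auto simp: numeral_2_eq_2 cofactor_def mat2_def det_single mat_delete_def)

lemma mat2_mult:
  "mat2 ((a, d), (b, c)) * mat2 ((a', d'), (b', c')) =
   mat2 ((a * a' + b * c', c * b' + d * d'), (a * b' + b * d', c * a' + d * c'))"
  by (rule eq_matI) (auto simp: mat2_def scalar_prod_def numeral_2_eq_2 less_Suc_eq)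

fun scalar2 :: "('a :: field \<times> 'a) \<times> ('a \<times> 'a) \<Rightarrow> bool" where
  "scalar2 ((a, d), (b, c)) \<longleftrightarrow> a = d \<and> b = 0 \<and> c = 0"

text \<open>The conditions are the vanishing 2 x 2 minors of the vectors (a - d, b, c) and (a' - d',
  b', c'): commuting means that these are linearly dependent.\<close>

fun commute2 :: "('a :: field \<times> 'a) \<times> ('a \<times> 'a) \<Rightarrow> ('a \<times> 'a) \<times> ('a \<times> 'a) \<Rightarrow> bool" where
  "commute2 ((a, d), (b, c)) ((a', d'), (b', c')) \<longleftrightarrow>
     b * c' = b' * c \<and> (a - d) * b' = (a' - d') * b \<and> (a - d) * c' = (a' - d') * c"

lemma mat2_mult_commute: "mat2 v * mat2 w = mat2 w * mat2 v \<longleftrightarrow> commute2 v w"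
proof -
  obtain a d b c a' d' b' c' where vw: "v = ((a, d), (b, c))" "w = ((a', d'), (b', c'))"
    by (metis surj_pair)
  have "mat2 v * mat2 w = mat2 w * mat2 v \<longleftrightarrow>
     a * a' + b * c' = a' * a + b' * c \<and> c * b' + d * d' = c' * b + d' * d \<and>
     a * b' + b * d' = a' * b + b' * d \<and> c * a' + d * c' = c' * a + d' * c"
    by (simp add: vw mat2_mult inj_eq[OF inj_mat2])
  also have "\<dots> \<longleftrightarrow> commute2 v w"
    \<comment> \<open>Both diagonal equations say b * c' = b' * c. Each off-diagonal equation and
      its counterpart in \<open>commute2\<close> have the same difference of sides.\<close>
    using eq_iff_diff_eq_0[of "a * b' + b * d'" "a' * b + b' * d"]
      eq_iff_diff_eq_0[of "(a - d) * b'" "(a' - d') * b"]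
      eq_iff_diff_eq_0[of "c' * a + d' * c" "c * a' + d * c'"]
      eq_iff_diff_eq_0[of "(a - d) * c'" "(a' - d') * c"]
    unfolding vw commute2.simps by (auto simp: algebra_simps)
  finally show ?thesis .
qed

text \<open>Some coordinate of (a - d, b, c) is nonzero because the matrix is not scalar. Dividing
  by it gives the ratio \<open>y\<close>, and \<open>x\<close> is what remains of the diagonal. Thus
  the centralizer is spanned by the identity and the matrix itself.\<close>

lemma commute2_iff:
  assumes "\<not> scalar2 ((a, d), (b, c))"
  shows "commute2 ((a, d), (b, c)) w \<longleftrightarrow>
         (\<exists>x y. w = ((x + y * a, x + y * d), (y * b, y * c)))"
proof
  assume "\<exists>x y. w = ((x + y * a, x + y * d), (y * b, y * c))"
  thus "commute2 ((a, d), (b, c)) w" by (auto simp: algebra_simps)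
next
  assume com: "commute2 ((a, d), (b, c)) w"
  obtain a' d' b' c' where w: "w = ((a', d'), (b', c'))" by (metis surj_pair)
  have com': "b * c' = b' * c" "(a - d) * b' = (a' - d') * b" "(a - d) * c' = (a' - d') * c"
    using com by (auto simp: w)
  have "\<exists>y. a' - d' = y * (a - d) \<and> b' = y * b \<and> c' = y * c"
  proof -
    consider "b \<noteq> 0" | "c \<noteq> 0" | "a - d \<noteq> 0" using assms by auto
    thus ?thesis
    proof cases
      case 1 thus ?thesis using com' by (intro exI[of _ "b' / b"]) (auto simp: field_simps)
    next
      case 2 thus ?thesis using com' by (intro exI[of _ "c' / c"]) (auto simp: field_simps)
    next
      case 3
      thus ?thesis using com'
        by (intro exI[of _ "(a' - d') / (a - d)"]) (simp add: nonzero_eq_divide_eq mult.commute)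
    qed
  qed
  then obtain y where y: "a' - d' = y * (a - d)" "b' = y * b" "c' = y * c" by blast
  have "w = (((a' - y * a) + y * a, (a' - y * a) + y * d), (y * b, y * c))"
    using y by (simp add: w algebra_simps)
  thus "\<exists>x y. w = ((x + y * a, x + y * d), (y * b, y * c))" by blast
qed

lemma commute2_sym: "commute2 v w \<longleftrightarrow> commute2 w v"
  unfolding mat2_mult_commute[symmetric] by auto

text \<open>Both outer matrices lie in the commutative algebra spanned by the identity and the
  nonscalar \<open>v\<close>.\<close>

lemma commute2_trans:
  assumes "\<not> scalar2 v" "commute2 u v" "commute2 v w"
  shows "commute2 u w"
proof -
  obtain a d b c where v: "v = ((a, d), (b, c))" by (metis surj_pair)
  have "commute2 v u" using assms(2) commute2_sym by blast
  then obtain x y where u: "u = ((x + y * a, x + y * d), (y * b, y * c))"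
    using assms(1) commute2_iff unfolding v by blast
  obtain x' y' where w: "w = ((x' + y' * a, x' + y' * d), (y' * b, y' * c))"
    using assms(1,3) commute2_iff unfolding v by blast
  show ?thesis by (simp add: u w algebra_simps)
qed

section \<open>The vertices and arcs of the graph for GL(2,q)\<close>

definition gl2_noncentral :: "(('a :: field \<times> 'a) \<times> ('a \<times> 'a)) set" where
  "gl2_noncentral = {((a, d), (b, c)). a * d \<noteq> b * c} - {v. scalar2 v}"

lemma carrier_GL2: "carrier (general_linear_group TYPE('a :: field) 2) =
    mat2 ` {((a, d), (b, c)). a * d \<noteq> b * c}"
proof -
  have "carrier (general_linear_group TYPE('a) 2) = {A \<in> carrier_mat 2 2. det A \<noteq> 0}"
    using unit_imp_det_non_zero[where 'a = 'a and b = "()" and n = 2]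
      det_non_zero_imp_unit[where 'a = 'a and b = "()" and n = 2]
    by (auto simp: general_linear_group_def units_of_carrier Units_def ring_mat_simps)
  also have "\<dots> = mat2 ` {((a, d), (b, c)). a * d \<noteq> b * c}"
    by (auto simp: carrier_mat_2_2 det_mat2 image_iff)
  finally show ?thesis .
qed

lemma mult_GL2: "x \<otimes>\<^bsub>general_linear_group TYPE('a :: field) m\<^esub> y = x * y"
  by (simp add: general_linear_group_def units_of_mult ring_mat_simps)

lemma centre_GL2: "group_centre (general_linear_group TYPE('a :: field) 2) =
    mat2 ` ({((a, d), (b, c)). a * d \<noteq> b * c} \<inter> {v. scalar2 v})"
proof -
  have "(\<forall>w\<in>{((a, d), (b, c)). a * d \<noteq> b * c}. commute2 v w) \<longleftrightarrow> scalar2 v"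
    for v :: "('a \<times> 'a) \<times> ('a \<times> 'a)"
  proof
    assume *: "\<forall>w\<in>{((a, d), (b, c)). a * d \<noteq> b * c}. commute2 v w"
    \<comment> \<open>The upper and lower elementary transvections; together they force the
      off-diagonal entries to vanish and the diagonal ones to agree.\<close>
    have "commute2 v ((1, 1), (1, 0))" "commute2 v ((1, 1), (0, 1))"
      using * by auto
    thus "scalar2 v" by (cases v rule: scalar2.cases) auto
  next
    assume "scalar2 v"
    thus "\<forall>w\<in>{((a, d), (b, c)). a * d \<noteq> b * c}. commute2 v w"
      by (cases v rule: scalar2.cases) auto
  qed
  thus ?thesis
    by (auto simp: group_centre_def carrier_GL2 mult_GL2 mat2_mult_commute image_iff)
qed

lemma pverts_GL2: "pverts (noncommuting_graph (general_linear_group TYPE('a :: field) 2)) =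
    mat2 ` gl2_noncentral"
  unfolding noncommuting_graph_def pair_pre_digraph.simps carrier_GL2 centre_GL2 gl2_noncentral_def
  by (subst image_set_diff[OF inj_mat2, symmetric]) (auto intro!: arg_cong[of _ _ "image mat2"])

lemma parcs_GL2: "parcs (noncommuting_graph (general_linear_group TYPE('a :: field) 2)) =
    {(x, y). x \<in> mat2 ` gl2_noncentral \<and> y \<in> mat2 ` gl2_noncentral \<and> x * y \<noteq> y * x}"
  using pverts_GL2[where 'a = 'a] by (simp add: noncommuting_graph_def mult_GL2)

section \<open>Counting matrices by their eigenvalues\<close>

lemma card_field_ge_2: "CARD('a :: {field, finite}) \<ge> 2"
proof -
  have "card {0, 1 :: 'a} \<le> CARD('a)" by (rule card_mono) auto
  thus ?thesis by simp
qed

text \<open>For k = 0 the solutions form two axes sharing the origin; otherwise a nonzero b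
  determines c. Counting in the integers keeps the later polynomial identities free of truncated
  subtraction.\<close>

lemma card_mult_eq:
  "int (card {(b, c). b * c = (k :: 'a :: {field, finite})}) =
     (if k = 0 then 2 * int CARD('a) - 1 else int CARD('a) - 1)"
proof (cases "k = 0")
  case True
  have "{(b, c). b * c = k} = UNIV \<times> {0} \<union> {0} \<times> (UNIV - {0})"
    using True by auto
  also have "card \<dots> = card ((UNIV :: 'a set) \<times> {0 :: 'a}) + card ({0 :: 'a} \<times> (UNIV - {0 :: 'a}))"
    by (rule card_Un_disjoint) auto
  also have "\<dots> = CARD('a) + (CARD('a) - 1)"
    by (simp only: card_cartesian_product) simp
  finally have "card {(b, c). b * c = k} = CARD('a) + (CARD('a) - 1)" .
  thus ?thesis using True card_field_ge_2[where 'a = 'a] by (simp add: of_nat_diff)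
next
  case False
  have "{(b, c). b * c = k} = (\<lambda>b. (b, k / b)) ` (UNIV - {0})"
    using False by (auto simp: image_iff field_simps)
  hence "card {(b, c). b * c = k} = CARD('a) - 1"
    by (simp add: card_image inj_on_def)
  thus ?thesis using False by (simp add: of_nat_diff)
qed

text \<open>The singular matrices are counted diagonal by diagonal: each diagonal fixes the product
  of the off-diagonal entries, and \<open>P\<close> collects those where this product is
  zero.\<close>

lemma card_quad_det_zero:
  "int (card {((a, d), (b, c)). a * d = b * (c :: 'a :: {field, finite})}) =
     int CARD('a) ^ 3 + int CARD('a) ^ 2 - int CARD('a)"
proof -
  define q where "q = int CARD('a)"
  define P where "P = {p :: 'a \<times> 'a. fst p * snd p = 0}"
  have cP: "int (card P) = 2 * q - 1"
    using card_mult_eq[of "0 :: 'a"] by (simp add: P_def q_def case_prod_unfold)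
  have cP': "int (card (UNIV - P)) = q\<^sup>2 - (2 * q - 1)"
  proof -
    have "card P \<le> CARD('a \<times> 'a)" by (rule card_mono) auto
    hence "int (card (UNIV - P)) = int CARD('a \<times> 'a) - int (card P)"
      by (subst card_Diff_subset) (auto simp: of_nat_diff)
    thus ?thesis using cP by (simp add: q_def power2_eq_square)
  qed
  have "{((a, d), (b, c)). a * d = b * (c :: 'a)} = (SIGMA p:UNIV. {(b, c). b * c = fst p * snd p})"
    by auto
  hence "int (card {((a, d), (b, c)). a * d = b * (c :: 'a)}) =
      (\<Sum>p\<in>UNIV. int (card {(b, c). b * c = fst p * (snd p :: 'a)}))"
    by (simp add: card_SigmaI)
  also have "\<dots> = (\<Sum>p\<in>UNIV. if p \<in> P then 2 * q - 1 else q - 1)"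
    by (simp only: card_mult_eq) (auto simp: P_def q_def intro!: sum.cong)
  also have "\<dots> = int (card P) * (2 * q - 1) + int (card (UNIV - P)) * (q - 1)"
    by (subst sum.If_cases) (auto simp: Compl_eq_Diff_UNIV)
  also have "\<dots> = q ^ 3 + q ^ 2 - q"
    unfolding cP cP' by (simp add: algebra_simps power2_eq_square power3_eq_cube)
  finally show ?thesis by (simp add: q_def)
qed

lemma card_gl2_noncentral:
  "int (card (gl2_noncentral :: (('a :: {field, finite} \<times> 'a) \<times> ('a \<times> 'a)) set)) =
     int CARD('a) ^ 4 - int CARD('a) ^ 3 - int CARD('a) ^ 2 + 1"
proof -
  define W where "W = {((a, d), (b, c)). a * d = b * (c :: 'a)}"
  \<comment> \<open>The zero matrix is left out because it is singular and already lies in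
    \<open>W\<close>.\<close>
  define T :: "(('a \<times> 'a) \<times> ('a \<times> 'a)) set"
    where "T = (\<lambda>x. ((x, x), (0, 0))) ` (UNIV - {0})"
  have eq: "gl2_noncentral = UNIV - (W \<union> T)"
    by (auto simp: gl2_noncentral_def W_def T_def)
  have "int (card (W \<union> T)) = int (card W) + int (card T)"
    by (subst card_Un_disjoint) (auto simp: W_def T_def)
  also have "int (card T) = int CARD('a) - 1"
    unfolding T_def by (subst card_image) (auto simp: inj_on_def of_nat_diff)
  finally have c: "int (card (W \<union> T)) = int CARD('a) ^ 3 + int CARD('a) ^ 2 - 1"
    using card_quad_det_zero[where 'a = 'a] by (simp add: W_def)
  have "card (W \<union> T) \<le> CARD(('a \<times> 'a) \<times> ('a \<times> 'a))" by (rule card_mono) auto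
  hence "int (card (UNIV - (W \<union> T))) = int CARD(('a \<times> 'a) \<times> ('a \<times> 'a)) - int (card (W \<union> T))"
    by (subst card_Diff_subset) (auto simp: of_nat_diff)
  thus ?thesis unfolding eq c by (simp add: power_def)
qed

text \<open>Only eigenvalues in the field itself count, without multiplicity: sizes 0, 1 and 2 stand
  for a characteristic polynomial that is irreducible, has a double root, or has two distinct
  roots.\<close>

fun eigenvalues2 :: "('a :: field \<times> 'a) \<times> ('a \<times> 'a) \<Rightarrow> 'a set" where
  "eigenvalues2 ((a, d), (b, c)) = {x. (a - x) * (d - x) = b * c}"

declare eigenvalues2.simps [simp del]

text \<open>Vieta: the trace fixes the second root. Subtracting the equation for \<open>x\<close>
  leaves a difference that splits into two linear factors.\<close>

lemma eigenvalues2_eq: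
  assumes "x \<in> eigenvalues2 ((a, d), (b, c))"
  shows "eigenvalues2 ((a, d), (b, c)) = {x, a + d - x}"
proof -
  have x: "(a - x) * (d - x) = b * c" using assms by (simp add: eigenvalues2.simps)
  have "(a - y) * (d - y) - b * c = (y - x) * (y - (a + d - x))" for y
    unfolding x[symmetric] by (simp add: algebra_simps)
  hence "(a - y) * (d - y) = b * c \<longleftrightarrow> y = x \<or> y = a + d - x" for y
    by (metis eq_iff_diff_eq_0 mult_eq_0_iff)
  thus ?thesis by (auto simp: eigenvalues2.simps)
qed

lemma eigenvalues2_cases:
  obtains "eigenvalues2 v = {}" | x where "eigenvalues2 v = {x}"
  | x y where "x \<noteq> y" "eigenvalues2 v = {x, y}"
proof (cases "eigenvalues2 v = {}")
  case False
  then obtain x where x: "x \<in> eigenvalues2 v" by blast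
  show ?thesis
    using eigenvalues2_eq[of x] x that by (cases v rule: eigenvalues2.cases) (metis insert_absorb2)
qed

text \<open>The matrices with characteristic polynomial \<open>(X - x) (X - y)\<close>, parametrized by their
  upper left entry and their off-diagonal entries.\<close>

definition split_mats :: "'a :: field \<Rightarrow> 'a \<Rightarrow> (('a \<times> 'a) \<times> ('a \<times> 'a)) set" where
  "split_mats x y = (\<lambda>(a, r). ((a, x + y - a), r)) `
     (SIGMA a:UNIV. {(b, c). b * c = - ((a - x) * (a - y))})"

text \<open>A root together with the trace determines the characteristic polynomial.\<close>

lemma split_mats_iff:
  "((a, d), (b, c)) \<in> split_mats x y \<longleftrightarrow> a + d = x + y \<and> x \<in> eigenvalues2 ((a, d), (b, c))"
proof -
  have "((a, d), (b, c)) \<in> split_mats x y \<longleftrightarrow> d = x + y - a \<and> b * c = - ((a - x) * (a - y))"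
    by (auto simp: split_mats_def image_iff)
  also have "\<dots> \<longleftrightarrow> d = x + y - a \<and> (a - x) * (d - x) = b * c"
  proof -
    have "(a - x) * (x + y - a - x) = - ((a - x) * (a - y))" by (simp add: algebra_simps)
    thus ?thesis by auto
  qed
  finally show ?thesis by (auto simp: algebra_simps eigenvalues2.simps)
qed

text \<open>The off-diagonal product vanishes exactly when the upper left entry is x or y. Such an
  entry allows 2q - 1 off-diagonal pairs, any other one q - 1, whence the extra q for distinct
  roots.\<close>

lemma card_split_mats:
  "int (card (split_mats x (y :: 'a :: {field, finite}))) =
     (if x = y then int CARD('a) ^ 2 else int CARD('a) ^ 2 + int CARD('a))"
proof -
  define q where "q = int CARD('a)"
  have "card (split_mats x y) = card (SIGMA a:UNIV. {(b, c). b * c = - ((a - x) * (a - y))})"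
    unfolding split_mats_def by (rule card_image) (auto simp: inj_on_def)
  hence "int (card (split_mats x y)) =
      (\<Sum>a\<in>UNIV. int (card {(b, c). b * c = - ((a - x) * (a - y))}))"
    by (simp add: card_SigmaI)
  also have "\<dots> = (\<Sum>a\<in>UNIV. if a \<in> {x, y} then 2 * q - 1 else q - 1)"
    by (simp only: card_mult_eq) (auto simp: q_def intro!: sum.cong)
  also have "\<dots> = int (card {x, y}) * (2 * q - 1) + int (card (UNIV - {x, y})) * (q - 1)"
    by (subst sum.If_cases)
       (simp_all only: finite Collect_mem_eq Int_UNIV_left Compl_eq_Diff_UNIV sum_constant)
  also have "int (card (UNIV - {x, y})) = q - int (card {x, y})"
  proof -
    have "card {x, y} \<le> CARD('a)" by (rule card_mono) auto
    thus ?thesis by (subst card_Diff_subset) (auto simp: q_def of_nat_diff)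
  qed
  finally show ?thesis
    by (auto simp: q_def[symmetric] algebra_simps power2_eq_square)
qed

lemma eigenvalues2_eq_doubleton:
  assumes "x \<noteq> y"
  shows "eigenvalues2 v = {x, y} \<longleftrightarrow> v \<in> split_mats x y"
proof -
  obtain a d b c where v: "v = ((a, d), (b, c))" by (metis surj_pair)
  show ?thesis
  proof
    assume *: "eigenvalues2 v = {x, y}"
    hence x: "x \<in> eigenvalues2 ((a, d), (b, c))" by (simp add: v)
    from eigenvalues2_eq[OF this] * have "y = a + d - x"
      using assms by (auto simp: v doubleton_eq_iff)
    thus "v \<in> split_mats x y" unfolding v split_mats_iff using x by auto
  next
    assume "v \<in> split_mats x y"
    thus "eigenvalues2 v = {x, y}"
      unfolding v split_mats_iff using eigenvalues2_eq by force
  qed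
qed

lemma eigenvalues2_eq_singleton: "eigenvalues2 v = {x} \<longleftrightarrow> v \<in> split_mats x x"
proof -
  obtain a d b c where v: "v = ((a, d), (b, c))" by (metis surj_pair)
  show ?thesis
  proof
    assume *: "eigenvalues2 v = {x}"
    hence x: "x \<in> eigenvalues2 ((a, d), (b, c))" by (simp add: v)
    from eigenvalues2_eq[OF this] * have "x = a + d - x"
      by (auto simp: v)
    hence "a + d = x + x" by (metis diff_add_cancel)
    thus "v \<in> split_mats x x" unfolding v split_mats_iff using x by auto
  next
    assume "v \<in> split_mats x x"
    thus "eigenvalues2 v = {x}"
      unfolding v split_mats_iff using eigenvalues2_eq by force
  qed
qed

lemma scalar2_eigenvalues2: "scalar2 v \<Longrightarrow> eigenvalues2 v = {fst (fst v)}"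
  by (cases v rule: scalar2.cases) (auto simp: eigenvalues2.simps)

lemma in_gl2_noncentral_iff:
  "v \<in> gl2_noncentral \<longleftrightarrow> 0 \<notin> eigenvalues2 v \<and> \<not> scalar2 v"
  by (cases v rule: scalar2.cases) (auto simp: gl2_noncentral_def eigenvalues2.simps)

text \<open>The matrices are grouped by their unordered pair of distinct nonzero eigenvalues; a
  scalar matrix has only one eigenvalue and cannot occur. Doubling avoids halving the number of
  pairs.\<close>

lemma card_two_eigenvalues:
  "2 * int (card {v \<in> gl2_noncentral. card (eigenvalues2 v :: 'a :: {field, finite} set) = 2}) =
     (int CARD('a) - 1) * (int CARD('a) - 2) * (int CARD('a) ^ 2 + int CARD('a))"
proof -
  define q where "q = int CARD('a)"
  define K where "K = {R :: 'a set. R \<subseteq> UNIV - {0} \<and> card R = 2}"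
  have "{v \<in> gl2_noncentral. card (eigenvalues2 v :: 'a set) = 2} =
        (\<Union>R\<in>K. {v. eigenvalues2 v = R})"
    by (auto simp: K_def in_gl2_noncentral_iff dest: scalar2_eigenvalues2)
  also have "card \<dots> = (\<Sum>R\<in>K. card {v. eigenvalues2 v = R})"
    by (rule card_UN_disjoint) auto
  finally have "int (card {v \<in> gl2_noncentral. card (eigenvalues2 v :: 'a set) = 2}) =
      (\<Sum>R\<in>K. int (card {v. eigenvalues2 v = R}))" by simp
  also have "\<dots> = (\<Sum>R\<in>K. q ^ 2 + q)"
  proof (rule sum.cong)
    fix R assume "R \<in> K"
    then obtain x y where "x \<noteq> y" "R = {x, y}" by (auto simp: K_def card_2_iff)
    thus "int (card {v. eigenvalues2 v = R}) = q ^ 2 + q"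
      by (simp add: eigenvalues2_eq_doubleton card_split_mats q_def)
  qed simp
  also have "\<dots> = int (card K) * (q ^ 2 + q)" by simp
  finally have *: "int (card {v \<in> gl2_noncentral. card (eigenvalues2 v :: 'a set) = 2}) =
      int (card K) * (q ^ 2 + q)" .
  have "card K = (CARD('a) - 1) choose 2"
    unfolding K_def by (subst n_subsets) auto
  hence "2 * card K = (CARD('a) - 1) * (CARD('a) - 1 - 1)"
    by (simp add: choose_two)
  hence "2 * int (card K) = int (CARD('a) - 1) * int (CARD('a) - 1 - 1)"
    by (metis of_nat_mult of_nat_numeral)
  \<comment> \<open>A field has at least two elements, so the repeated natural subtraction is
    exact.\<close>
  also have "\<dots> = (q - 1) * (q - 2)"
    using card_le_Suc0_iff_eq[of "UNIV :: 'a set"] zero_neq_one[where 'a = 'a]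
    by (cases "CARD('a) \<ge> 2") (auto simp: q_def of_nat_diff)
  finally show ?thesis unfolding * q_def[symmetric] by (metis mult.assoc)
qed

text \<open>For each nonzero x there are q^2 matrices with characteristic polynomial (X - x)^2, and
  only the scalar one among them is central.\<close>

lemma card_one_eigenvalue:
  "int (card {v \<in> gl2_noncentral. card (eigenvalues2 v :: 'a :: {field, finite} set) = 1}) =
     (int CARD('a) - 1) * (int CARD('a) ^ 2 - 1)"
proof -
  have "{v \<in> gl2_noncentral. card (eigenvalues2 v :: 'a set) = 1} =
        (\<Union>x\<in>UNIV - {0}. split_mats x x - {((x, x), (0, 0))})"
  proof (rule Set.set_eqI)
    fix v :: "('a \<times> 'a) \<times> ('a \<times> 'a)"
    have sc: "scalar2 v \<longleftrightarrow> v = ((x, x), (0, 0))" if "eigenvalues2 v = {x}" for x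
    proof
      assume v: "scalar2 v"
      have "fst (fst v) = x" using that scalar2_eigenvalues2[OF v] by simp
      thus "v = ((x, x), (0, 0))" using v by (cases v rule: scalar2.cases) auto
    qed simp
    show "v \<in> {v \<in> gl2_noncentral. card (eigenvalues2 v :: 'a set) = 1} \<longleftrightarrow>
          v \<in> (\<Union>x\<in>UNIV - {0}. split_mats x x - {((x, x), (0, 0))})"
      using sc by (auto simp: in_gl2_noncentral_iff card_1_singleton_iff
          eigenvalues2_eq_singleton[symmetric])
  qed
  also have "card \<dots> = (\<Sum>x\<in>UNIV - {0 :: 'a}. card (split_mats x x - {((x, x), (0, 0))}))"
    by (rule card_UN_disjoint) (auto simp: eigenvalues2_eq_singleton[symmetric])
  also have "\<dots> = (\<Sum>x\<in>UNIV - {0 :: 'a}. CARD('a) ^ 2 - 1)"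
  proof (rule sum.cong)
    fix x :: 'a
    have "((x, x), (0, 0)) \<in> split_mats x x" by (simp add: split_mats_iff eigenvalues2.simps)
    moreover have "card (split_mats x x) = CARD('a) ^ 2"
      using card_split_mats[of x x] by (metis of_nat_eq_iff of_nat_power)
    ultimately show "card (split_mats x x - {((x, x), (0, 0))}) = CARD('a) ^ 2 - 1" by simp
  qed simp
  finally show ?thesis by (simp add: of_nat_diff)
qed

section \<open>Centralizers as the parts of the graph\<close>

text \<open>A matrix commuting with the nonscalar A is x I + y A. It is nonscalar exactly when y is
  nonzero, and then singular exactly when -x / y is an eigenvalue of A. So each of the q - 1 values
  of y excludes one x per eigenvalue.\<close>

lemma card_commute2:
  fixes v :: "('a :: {field, finite} \<times> 'a) \<times> ('a \<times> 'a)"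
  assumes v: "v \<in> gl2_noncentral"
  shows "card {w \<in> gl2_noncentral. commute2 v w} =
         (CARD('a) - 1) * (CARD('a) - card (eigenvalues2 v))"
proof -
  obtain a d b c where v': "v = ((a, d), (b, c))" by (metis surj_pair)
  have ns: "\<not> scalar2 ((a, d), (b, c))" using v by (simp add: v' in_gl2_noncentral_iff)
  define f where "f = (\<lambda>(y, x). ((x + y * a, x + y * d), (y * b, y * c)))"
  define X where "X = (SIGMA y:UNIV - {0}. UNIV - (\<lambda>x. - y * x) ` eigenvalues2 v)"
  have ev: "0 \<in> eigenvalues2 (f (y, x)) \<longleftrightarrow> x \<in> (\<lambda>x. - y * x) ` eigenvalues2 v" if "y \<noteq> 0" for x y
  proof -
    \<comment> \<open>With this z, det (x I + y A) = y^2 det (A - z I).\<close>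
    define z where "z = - x / y"
    have x: "x = - y * z" using that by (simp add: z_def)
    have "0 \<in> eigenvalues2 (f (y, x)) \<longleftrightarrow> (y * y) * ((a - z) * (d - z)) = (y * y) * (b * c)"
      unfolding x f_def by (simp add: algebra_simps eigenvalues2.simps)
    also have "\<dots> \<longleftrightarrow> z \<in> eigenvalues2 v" using that by (simp add: v' eigenvalues2.simps)
    also have "\<dots> \<longleftrightarrow> x \<in> (\<lambda>x. - y * x) ` eigenvalues2 v"
      unfolding x using that by auto
    finally show ?thesis .
  qed
  have sc: "scalar2 (f (y, x)) \<longleftrightarrow> y = 0" for x y
    using ns by (auto simp: f_def)
  have "{w \<in> gl2_noncentral. commute2 v w} = f ` X"
  proof (intro equalityI subsetI)
    fix w assume w: "w \<in> {w \<in> gl2_noncentral. commute2 v w}"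
    then obtain x y where "w = f (y, x)"
      using commute2_iff[OF ns] unfolding v' f_def by auto
    with w ev[of y x] sc[of y x] show "w \<in> f ` X"
      by (auto simp: X_def in_gl2_noncentral_iff)
  next
    fix w assume "w \<in> f ` X"
    then obtain x y where w: "w = f (y, x)" "y \<noteq> 0" "x \<notin> (\<lambda>x. - y * x) ` eigenvalues2 v"
      by (auto simp: X_def)
    have "commute2 v w" unfolding v' commute2_iff[OF ns] w(1) f_def by auto
    with w ev[of y x] sc[of y x] show "w \<in> {w \<in> gl2_noncentral. commute2 v w}"
      by (auto simp: in_gl2_noncentral_iff)
  qed
  moreover have "inj f"
  proof (rule injI)
    fix p p' assume "f p = f p'"
    moreover obtain y x y' x' where p: "p = (y, x)" "p' = (y', x')" by (metis surj_pair)
    ultimately have eqs: "x + y * a = x' + y' * a" "x + y * d = x' + y' * d" "y * b = y' * b" "y * c = y' * c"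
      by (auto simp: f_def)
    \<comment> \<open>All coordinates of (a - d, b, c) are annihilated by y - y', and one of them is
      nonzero.\<close>
    have "(y - y') * (a - d) = (x + y * a - (x' + y' * a)) - (x + y * d - (x' + y' * d))"
      by (simp add: algebra_simps)
    hence "(y - y') * (a - d) = 0" unfolding eqs by simp
    hence "y = y'" using ns eqs by auto
    thus "p = p'" using eqs by (simp add: p)
  qed
  ultimately have "card {w \<in> gl2_noncentral. commute2 v w} = card X"
    by (metis card_image inj_on_subset subset_UNIV)
  also have "\<dots> = (\<Sum>y\<in>UNIV - {0}. card (UNIV - (\<lambda>x. - y * x) ` eigenvalues2 v))"
    unfolding X_def by (rule card_SigmaI) auto
  also have "\<dots> = (\<Sum>y\<in>UNIV - {0 :: 'a}. CARD('a) - card (eigenvalues2 v))"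
  proof (rule sum.cong)
    fix y :: 'a assume "y \<in> UNIV - {0}"
    hence "card ((\<lambda>x. - y * x) ` eigenvalues2 v) = card (eigenvalues2 v)"
      by (intro card_image) (auto simp: inj_on_def)
    thus "card (UNIV - (\<lambda>x. - y * x) ` eigenvalues2 v) = CARD('a) - card (eigenvalues2 v)"
      by (subst card_Diff_subset) auto
  qed simp
  finally show ?thesis by simp
qed

text \<open>Serves as the label of the part containing \<open>v\<close>: on noncentral elements it
  is the class of \<open>v\<close> under commuting.\<close>

definition gl2_centralizer ::
    "('a :: field \<times> 'a) \<times> ('a \<times> 'a) \<Rightarrow> (('a \<times> 'a) \<times> ('a \<times> 'a)) set" where
  "gl2_centralizer v = {w \<in> gl2_noncentral. commute2 v w}"

lemma gl2_centralizer_eq_iff: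
  assumes "v \<in> gl2_noncentral" "w \<in> gl2_noncentral"
  shows "gl2_centralizer v = gl2_centralizer w \<longleftrightarrow> commute2 v w"
proof
  have "commute2 w w" by (cases w rule: scalar2.cases) simp
  hence "w \<in> gl2_centralizer w" using assms by (simp add: gl2_centralizer_def)
  moreover assume "gl2_centralizer v = gl2_centralizer w"
  ultimately show "commute2 v w" by (auto simp: gl2_centralizer_def)
next
  assume "commute2 v w"
  moreover have "\<not> scalar2 v" "\<not> scalar2 w" using assms by (auto simp: in_gl2_noncentral_iff)
  ultimately show "gl2_centralizer v = gl2_centralizer w"
    unfolding gl2_centralizer_def using commute2_trans commute2_sym by blast
qed

text \<open>Commuting is equality of labels, so each label is its own fibre and the size of a part
  is simply \<open>card b\<close>.\<close>

lemma gl2_centralizer_fibre: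
  assumes "v \<in> gl2_noncentral"
  shows "{w \<in> gl2_noncentral. gl2_centralizer w = gl2_centralizer v} = gl2_centralizer v"
proof -
  have "gl2_centralizer w = gl2_centralizer v \<longleftrightarrow> commute2 v w" if "w \<in> gl2_noncentral" for w
    using gl2_centralizer_eq_iff[OF assms that] by (simp only: eq_commute)
  thus ?thesis by (simp add: gl2_centralizer_def cong: conj_cong)
qed

text \<open>Double counting: \<open>W\<close> is a disjoint union of classes, all of the size given
  by \<open>card_commute2\<close>.\<close>

lemma card_gl2_centralizers:
  fixes j :: nat
  defines "W \<equiv> {v \<in> gl2_noncentral. card (eigenvalues2 v :: 'a :: {field, finite} set) = j}"
  shows "card (gl2_centralizer ` W) * ((CARD('a) - 1) * (CARD('a) - j)) = card W"
proof -
  have "card W = (\<Sum>b\<in>gl2_centralizer ` W. card {v \<in> W. gl2_centralizer v = b})"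
    using sum.image_gen[of W "\<lambda>_. 1 :: nat" gl2_centralizer] by simp
  also have "\<dots> = (\<Sum>b\<in>gl2_centralizer ` W. (CARD('a) - 1) * (CARD('a) - j))"
  proof (rule sum.cong)
    fix b assume "b \<in> gl2_centralizer ` W"
    then obtain v where v: "v \<in> W" "b = gl2_centralizer v" by blast
    \<comment> \<open>Commuting elements share a class, and its size determines the number of
      eigenvalues: q - 1 is positive and the subtraction from q is not truncated.\<close>
    have "card (eigenvalues2 w) = card (eigenvalues2 v)" if "w \<in> gl2_centralizer v" for w
    proof -
      have w: "w \<in> gl2_noncentral" "commute2 v w" using that by (auto simp: gl2_centralizer_def)
      hence "gl2_centralizer w = gl2_centralizer v"
        using v gl2_centralizer_eq_iff[of v w] by (simp add: W_def)
      hence "(CARD('a) - 1) * (CARD('a) - card (eigenvalues2 w)) =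
             (CARD('a) - 1) * (CARD('a) - card (eigenvalues2 v))"
        using card_commute2[of w] card_commute2[of v] v w by (simp add: W_def gl2_centralizer_def)
      hence "CARD('a) - card (eigenvalues2 w) = CARD('a) - card (eigenvalues2 v)"
        using card_field_ge_2[where 'a = 'a] by simp
      moreover have "card (eigenvalues2 w) \<le> CARD('a)" "card (eigenvalues2 v) \<le> CARD('a)"
        by (auto intro: card_mono)
      ultimately show ?thesis by linarith
    qed
    hence "{w \<in> W. gl2_centralizer w = b} =
        {w \<in> gl2_noncentral. gl2_centralizer w = gl2_centralizer v}"
      using v gl2_centralizer_fibre[of v] by (auto simp: W_def)
    also have "\<dots> = gl2_centralizer v"
      using v gl2_centralizer_fibre[of v] by (simp add: W_def)
    finally have "{w \<in> W. gl2_centralizer w = b} = gl2_centralizer v" .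
    thus "card {w \<in> W. gl2_centralizer w = b} = (CARD('a) - 1) * (CARD('a) - j)"
      using v card_commute2[of v] by (simp add: W_def gl2_centralizer_def)
  qed simp
  finally show ?thesis by simp
qed

lemma sum_replicate_mset_const: "(\<Sum>b\<in>B. replicate_mset m x) = replicate_mset (card B * m) x"
  by (rule multiset_eqI) (simp add: count_sum)

text \<open>Labelling each vertex by the centralizer of its coordinates makes the graph complete
  multipartite, with the elements of \<open>C\<close> as parts in coordinates.\<close>

lemma laplacian_spectrum_GL2:
  fixes vs :: "'a :: {field, finite} mat list"
  defines "\<Gamma> \<equiv> noncommuting_graph (general_linear_group TYPE('a) 2)"
  defines "C \<equiv> gl2_centralizer ` (gl2_noncentral :: (('a \<times> 'a) \<times> ('a \<times> 'a)) set)"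
  defines "N \<equiv> card (gl2_noncentral :: (('a \<times> 'a) \<times> ('a \<times> 'a)) set)"
  assumes vs: "distinct vs" "set vs = pverts \<Gamma>"
  shows "laplacian_spectrum \<Gamma> vs = {#0#} + replicate_mset (card C - 1) (real N) +
           (\<Sum>b\<in>C. replicate_mset (card b - 1) (real N - real (card b)))"
proof -
  define V where "V = (gl2_noncentral :: (('a \<times> 'a) \<times> ('a \<times> 'a)) set)"
  define c where "c = (\<lambda>A :: 'a mat. gl2_centralizer (inv_into UNIV mat2 A))"
  have c: "c (mat2 v) = gl2_centralizer v" for v by (simp add: c_def inv_into_f_f[OF inj_mat2])
  have pv: "pverts \<Gamma> = mat2 ` V" by (simp add: \<Gamma>_def pverts_GL2 V_def)
  have inj: "inj_on mat2 X" for X :: "(('a \<times> 'a) \<times> ('a \<times> 'a)) set"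
    using inj_mat2 by (rule inj_on_subset) auto
  have arcs: "parcs \<Gamma> = {(x, y). x \<in> pverts \<Gamma> \<and> y \<in> pverts \<Gamma> \<and> c x \<noteq> c y}"
  proof -
    have "c x = c y \<longleftrightarrow> x * y = y * x" if xy: "x \<in> mat2 ` V" "y \<in> mat2 ` V" for x y
    proof -
      obtain v w where "x = mat2 v" "y = mat2 w" "v \<in> V" "w \<in> V" using xy by blast
      thus ?thesis by (simp add: c mat2_mult_commute gl2_centralizer_eq_iff V_def)
    qed
    thus ?thesis unfolding pv unfolding \<Gamma>_def parcs_GL2 V_def[symmetric] by blast
  qed
  \<comment> \<open>The matrix swapping the two basis vectors is a vertex.\<close>
  have "((0, 0), (1, 1)) \<in> V" by (auto simp: V_def gl2_noncentral_def)
  hence ne: "pverts \<Gamma> \<noteq> {}" unfolding pv by blast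
  have CC: "c ` pverts \<Gamma> = C" unfolding pv by (simp add: image_image c C_def V_def)
  have NN: "card (pverts \<Gamma>) = N" unfolding pv by (simp add: card_image inj N_def V_def)
  have s: "card {x \<in> pverts \<Gamma>. c x = b} = card b" if b: "b \<in> C" for b
  proof -
    obtain v where v: "v \<in> V" "b = gl2_centralizer v" using b by (auto simp: C_def V_def)
    have "{x \<in> pverts \<Gamma>. c x = b} = mat2 ` {w \<in> V. c (mat2 w) = b}"
      unfolding pv by blast
    also have "\<dots> = mat2 ` {w \<in> V. gl2_centralizer w = gl2_centralizer v}"
      by (simp only: c v(2))
    also have "{w \<in> V. gl2_centralizer w = gl2_centralizer v} = b"
      using v gl2_centralizer_fibre[of v] by (simp add: V_def)
    finally show ?thesis by (simp add: card_image inj)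
  qed
  show ?thesis
    unfolding laplacian_spectrum_complete_multipartite[OF vs arcs ne] CC NN
    by (simp add: s)
qed

section \<open>Class numbers and the spectrum for GL(2,q)\<close>

theorem proposition4p4:
  fixes p n q :: nat
    and vs :: "'a :: {field, finite} mat list"
  assumes "prime p" and "n \<ge> 1" and "q = p ^ n" and "q > 2"
    and "CARD('a) = q"
    and "distinct vs"
    and "set vs = pverts (noncommuting_graph (general_linear_group TYPE('a) 2))"
  shows "laplacian_spectrum (noncommuting_graph (general_linear_group TYPE('a) 2)) vs =
      {#0#}
    + replicate_mset ((q^4 - 2 * q^3 + q) div 2)
        (real q^4 - real q^3 - 2 * real q^2 + real q + 1)
    + replicate_mset (q^3 - q^2 - 2 * q)
        (real q^4 - real q^3 - 2 * real q^2 + 2 * real q)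
    + replicate_mset ((q^4 - 2 * q^3 - 2 * q^2 + q) div 2)
        (real q^4 - real q^3 - 2 * real q^2 + 3 * real q - 1)
    + replicate_mset (q^2 + q)
        (real q^4 - real q^3 - real q^2 + 1)"
proof -
  define V where "V = (gl2_noncentral :: (('a \<times> 'a) \<times> ('a \<times> 'a)) set)"
  define W where "W j = {v \<in> V. card (eigenvalues2 v) = j}" for j
  define C where "C j = gl2_centralizer ` W j" for j
  define k where "k j = card (C j)" for j
  define s where "s j = (q - 1) * (q - j)" for j
  define N where "N = card V"
  note q = \<open>CARD('a) = q\<close>
  have V: "V = W 0 \<union> (W 1 \<union> W 2)"
  proof -
    have "card (eigenvalues2 v) \<in> {0, 1, 2}" for v :: "('a \<times> 'a) \<times> ('a \<times> 'a)"
      by (cases rule: eigenvalues2_cases[of v]) auto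
    thus ?thesis unfolding W_def by blast
  qed
  have cardC: "card b = s j" if "b \<in> C j" for b j
    using that card_commute2[where 'a = 'a] by (auto simp: C_def W_def V_def s_def gl2_centralizer_def q)
  \<comment> \<open>Distinct sizes keep the three families of classes disjoint, so that sums over
    all classes split.\<close>
  have s_neq: "s 0 \<noteq> s 1" "s 0 \<noteq> s 2" "s 1 \<noteq> s 2"
    using \<open>q > 2\<close> by (auto simp: s_def)
  have "C i \<inter> C j = {}" if "s i \<noteq> s j" for i j
  proof -
    have "False" if "b \<in> C i" "b \<in> C j" for b
      using cardC[OF that(1)] cardC[OF that(2)] \<open>s i \<noteq> s j\<close> by simp
    thus ?thesis by blast
  qed
  hence disj: "C 0 \<inter> (C 1 \<union> C 2) = {}" "C 1 \<inter> C 2 = {}"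
    using s_neq by (simp_all add: Int_Un_distrib)
  have CV: "gl2_centralizer ` V = C 0 \<union> (C 1 \<union> C 2)"
    unfolding V C_def by (simp add: image_Un)
  have sumC: "(\<Sum>b\<in>C j. replicate_mset (card b - 1) (real N - real (card b))) =
      replicate_mset (k j * (s j - 1)) (real N - real (s j))" for j
    unfolding k_def sum_replicate_mset_const[symmetric]
    by (rule sum.cong) (auto dest: cardC)
  have spectrum: "laplacian_spectrum (noncommuting_graph (general_linear_group TYPE('a) 2)) vs =
      {#0#} + replicate_mset (k 0 + k 1 + k 2 - 1) (real N) +
      (replicate_mset (k 0 * (s 0 - 1)) (real N - real (s 0)) +
       replicate_mset (k 1 * (s 1 - 1)) (real N - real (s 1)) +
       replicate_mset (k 2 * (s 2 - 1)) (real N - real (s 2)))"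
  proof -
    have fin: "finite (C j)" for j by simp
    have "card (gl2_centralizer ` V) = k 0 + k 1 + k 2"
      unfolding CV k_def card_Un_disjoint[OF fin finite_UnI[OF fin fin] disj(1)]
        card_Un_disjoint[OF fin fin disj(2)] by simp
    moreover have "(\<Sum>b\<in>gl2_centralizer ` V. replicate_mset (card b - 1) (real N - real (card b))) =
        replicate_mset (k 0 * (s 0 - 1)) (real N - real (s 0)) +
       replicate_mset (k 1 * (s 1 - 1)) (real N - real (s 1)) +
       replicate_mset (k 2 * (s 2 - 1)) (real N - real (s 2))"
      unfolding CV sum.union_disjoint[OF fin finite_UnI[OF fin fin] disj(1)]
        sum.union_disjoint[OF fin fin disj(2)] sumC by (simp only: add.assoc)
    ultimately show ?thesis
      using laplacian_spectrum_GL2[OF assms(6,7)] by (simp add: V_def N_def)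
  qed
  have
    k1: "int (k 1) = int q + 1" and
    k2: "2 * int (k 2) = int q ^ 2 + int q" and
    k0: "2 * int (k 0) = int q ^ 2 - int q" and
    N: "int N = int q ^ 4 - int q ^ 3 - int q ^ 2 + 1"
  proof -
    show N: "int N = int q ^ 4 - int q ^ 3 - int q ^ 2 + 1"
      using card_gl2_noncentral[where 'a = 'a] by (simp add: N_def V_def q)
    \<comment> \<open>These factors are cancelled from the class equations below; q > 2 makes q - 2
      nonzero.\<close>
    have pos: "int q - 1 \<noteq> 0" "int q - 2 \<noteq> 0" "int q \<noteq> 0" using \<open>q > 2\<close> by auto
    have kW: "int (k j) * ((int q - 1) * (int q - int j)) = int (card (W j))" if "j \<le> 2" for j
    proof -
      have "k j * ((q - 1) * (q - j)) = card (W j)"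
        using card_gl2_centralizers[where j = j and 'a = 'a]
        by (simp add: k_def C_def W_def V_def q)
      hence "int (k j) * (int (q - 1) * int (q - j)) = int (card (W j))"
        by (metis of_nat_mult)
      thus ?thesis using that \<open>q > 2\<close> by (simp add: of_nat_diff)
    qed
    have W1: "int (card (W 1)) = (int q - 1) * (int q ^ 2 - 1)"
      using card_one_eigenvalue[where 'a = 'a] by (simp add: W_def V_def q)
    have W2: "2 * int (card (W 2)) = (int q - 1) * (int q - 2) * (int q ^ 2 + int q)"
      using card_two_eigenvalues[where 'a = 'a] by (simp add: W_def V_def q)
    have "card V = card (W 0) + (card (W 1) + card (W 2))"
      unfolding V by (subst card_Un_disjoint, auto simp: W_def)+
    hence W0: "int N = int (card (W 0)) + int (card (W 1)) + int (card (W 2))"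
      by (simp add: N_def)
    have "(int q - 1) * (int q - 1) * int (k 1) = (int q - 1) * (int q - 1) * (int q + 1)"
      using kW[of 1] W1 by (simp add: algebra_simps power2_eq_square)
    thus "int (k 1) = int q + 1" using pos by simp
    have "(int q - 1) * (int q - 2) * (2 * int (k 2)) =
          (int q - 1) * (int q - 2) * (int q ^ 2 + int q)"
      using kW[of 2] W2 by (simp add: mult_ac)
    thus "2 * int (k 2) = int q ^ 2 + int q" using pos by simp
    \<comment> \<open>Matrices without eigenvalues in the field are counted as the complement of the
      other two kinds.\<close>
    have "(int q - 1) * int q * (2 * int (k 0)) = 2 * int (card (W 0))"
      using kW[of 0, symmetric] by (simp add: algebra_simps)
    also have "\<dots> = 2 * int N - 2 * int (card (W 1)) - 2 * int (card (W 2))"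
      using W0 by simp
    also have "\<dots> = (int q - 1) * int q * (int q ^ 2 - int q)"
      unfolding N W1 W2 by (simp add: algebra_simps eval_nat_numeral)
    finally show "2 * int (k 0) = int q ^ 2 - int q" using pos by simp
  qed
  \<comment> \<open>There are q^2 + q + 1 parts, one more than the multiplicity of the eigenvalue
    N.\<close>
  have parts: "k 0 + k 1 + k 2 - 1 = q ^ 2 + q"
  proof -
    have "2 * int (k 0 + k 1 + k 2) = 2 * int (q ^ 2 + q + 1)"
      using k0 k1 k2 by simp
    hence "k 0 + k 1 + k 2 = q ^ 2 + q + 1" by (simp only: mult_cancel_left of_nat_eq_iff) simp
    thus ?thesis by simp
  qed
  have N': "real N = real q ^ 4 - real q ^ 3 - real q ^ 2 + 1"
    using arg_cong[OF N, of real_of_int] by simp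
  have s: "real (s j) = (real q - 1) * (real q - real j)" if "j \<le> 2" for j
    unfolding s_def of_nat_mult using that \<open>q > 2\<close> by (simp add: of_nat_diff)
  have ev: "real N - real (s 0) = real q^4 - real q^3 - 2 * real q^2 + real q + 1"
      "real N - real (s 1) = real q^4 - real q^3 - 2 * real q^2 + 2 * real q"
      "real N - real (s 2) = real q^4 - real q^3 - 2 * real q^2 + 3 * real q - 1"
    unfolding N' by (simp_all add: s algebra_simps power2_eq_square)
  \<comment> \<open>Writing q as m + 3 turns each \<open>s j - 1\<close> into a polynomial in m with
    natural coefficients, so no subtraction is left.\<close>
  obtain m where m: "q = m + 3"
    using \<open>q > 2\<close> by (metis add.commute le_Suc_ex less_eq_Suc_le numeral_2_eq_2 numeral_3_eq_3)
  have mult0: "k 0 * (s 0 - 1) = (q^4 - 2 * q^3 + q) div 2"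
  proof -
    have "int (2 * k 0) = int ((m + 2) * (m + 3))"
      using k0 by (simp add: m algebra_simps power2_eq_square)
    hence k: "2 * k 0 = (m + 2) * (m + 3)" by (simp only: of_nat_eq_iff)
    have s: "s 0 - 1 = m ^ 2 + 5 * m + 5" by (simp add: s_def m algebra_simps power2_eq_square)
    have "2 * k 0 * (s 0 - 1) + 2 * q ^ 3 = q ^ 4 + q"
      unfolding k s m by (simp add: algebra_simps power4_eq_xxxx power3_eq_cube power2_eq_square)
    \<comment> \<open>The claimed multiplicity adds q after a natural subtraction, so that
      subtraction must be shown not to truncate.\<close>
    moreover have "2 * q ^ 3 \<le> q ^ 4"
      unfolding m by (simp add: algebra_simps power4_eq_xxxx power3_eq_cube power2_eq_square)
    ultimately show ?thesis by simp
  qed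
  have mult1: "k 1 * (s 1 - 1) = q^3 - q^2 - 2 * q"
  proof -
    have k: "k 1 = m + 4" using k1 by (simp add: m)
    have s: "s 1 - 1 = m ^ 2 + 4 * m + 3" by (simp add: s_def m algebra_simps power2_eq_square)
    have "k 1 * (s 1 - 1) + q ^ 2 + 2 * q = q ^ 3"
      unfolding k s m by (simp add: algebra_simps power4_eq_xxxx power3_eq_cube power2_eq_square)
    thus ?thesis by simp
  qed
  have mult2: "k 2 * (s 2 - 1) = (q^4 - 2 * q^3 - 2 * q^2 + q) div 2"
  proof -
    have "int (2 * k 2) = int ((m + 3) * (m + 4))"
      using k2 by (simp add: m algebra_simps power2_eq_square)
    hence k: "2 * k 2 = (m + 3) * (m + 4)" by (simp only: of_nat_eq_iff)
    have s: "s 2 - 1 = m ^ 2 + 3 * m + 1" by (simp add: s_def m algebra_simps power2_eq_square)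
    have "2 * k 2 * (s 2 - 1) + 2 * q ^ 3 + 2 * q ^ 2 = q ^ 4 + q"
      unfolding k s m by (simp add: algebra_simps power4_eq_xxxx power3_eq_cube power2_eq_square)
    moreover have "2 * q ^ 3 + 2 * q ^ 2 \<le> q ^ 4"
      unfolding m by (simp add: algebra_simps power4_eq_xxxx power3_eq_cube power2_eq_square)
    ultimately show ?thesis by simp
  qed
  show ?thesis
    unfolding spectrum parts ev mult0 mult1 mult2 unfolding N' by (simp only: union_ac)
qed

end
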